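(* Let $\mu\in\Omega$ (a nonzero finite Borel measure on $S^{n-1}$ not concentrated on any hemisphere of $S^{n-1}$) and let $\varphi\in\mathcal{I}$. Then there exists a convex body $M\in\mathcal{K}_0$ such that $|M^\circ|=\omega_n$ and $$\int_{S^{n-1}}\varphi(h_M(u))\,d\mu(u)=\inf\bigg\{\int_{S^{n-1}}\varphi(h_L(u))\,d\mu(u):\ L\in\mathcal{K}_0\ \text{and}\ |L^\circ|=\omega_n\bigg\}.$$ Moreover, if $\varphi\in\mathcal{I}$ is convex, then $M$ is the unique solution, i.e. the unique convex body in $\mathcal{K}_0$ with $|M^\circ|=\omega_n$ attaining this infimum.
   Context: $\mathcal{K}_0$ is the set of all convex bodies (compact convex subsets of $\mathbb{R}^n$ with nonempty interior) having the origin $o$ in their interiors. $S^{n-1}$ is the unit sphere of $\mathbb{R}^n$. For $L\in\mathcal{K}_0$, $h_L(u)=\max_{x\in L}\langle x,u\rangle$ ($u\in S^{n-1}$) is its support function, $L^\circ=\{y\in\mathbb{R}^n:\langle x,y\rangle\le 1\ \text{for all}\ x\in L\}$ is its polar body, and $|L|$ is its volume; $\omega_n$ is the volume of the Euclidean unit ball $B_2^n$. $\mathcal{I}$ is the set of continuous functions $\varphi:(0,\infty)\to(0,\infty)$ that are strictly increasing with $\lim_{t\to0^+}\varphi(t)=0$, $\varphi(1)=1$ and $\lim_{t\to\infty}\varphi(t)=\infty$. $\Omega$ is the set of all nonzero finite Borel measures $\mu$ on $S^{n-1}$ that are not concentrated on any hemisphere, i.e. $\int_{S^{n-1}}\langle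 u,v\rangle_+\,d\mu(u)>0$ for every $v\in S^{n-1}$, where $a_+=\max\{a,0\}$. *)

theory Defs
  imports "HOL-Analysis.Analysis"
begin

definition convex_body :: "(real ^ 'n) set \<Rightarrow> bool" where
  "convex_body K \<longleftrightarrow> compact K \<and> convex K \<and> interior K \<noteq> {}"

definition convex_bodies_o :: "(real ^ 'n) set set" where
  "convex_bodies_o = {K. convex_body K \<and> 0 \<in> interior K}"

text \<open>For nonempty compact sets the supremum below is a maximum, see
  \<open>support_fun_attained\<close>.\<close>

definition support_fun :: "(real ^ 'n) set \<Rightarrow> real ^ 'n \<Rightarrow> real" where
  "support_fun L u = (SUP x\<in>L. x \<bullet> u)"

lemma support_fun_attained:
  fixes L :: "(real ^ 'n) set"
  assumes "compact L" "L \<noteq> {}"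
  shows "\<exists>x\<in>L. support_fun L u = x \<bullet> u \<and> (\<forall>y\<in>L. y \<bullet> u \<le> x \<bullet> u)"
proof -
  have "continuous_on L (\<lambda>x. x \<bullet> u)"
    by (intro continuous_intros)
  then obtain x where x: "x \<in> L" "\<forall>y\<in>L. y \<bullet> u \<le> x \<bullet> u"
    using continuous_attains_sup[OF assms] by blast
  then have "(SUP y\<in>L. y \<bullet> u) = x \<bullet> u"
    by (intro cSup_eq_maximum) auto
  with x show ?thesis
    unfolding support_fun_def by blast
qed

definition polar_body :: "(real ^ 'n) set \<Rightarrow> (real ^ 'n) set" where
  "polar_body L = {y. \<forall>x\<in>L. x \<bullet> y \<le> 1}"

definition volume :: "(real ^ 'n) set \<Rightarrow> real" where
  "volume K = measure lebesgue K"

definition normalized_bodies :: "(real ^ 'n) set set" where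
  "normalized_bodies =
    {L \<in> convex_bodies_o. volume (polar_body L) = volume (cball (0 :: real ^ 'n) 1)}"

text \<open>Functions \<open>(0,\<infinity>) \<rightarrow> (0,\<infinity>)\<close> are represented by total functions on the reals whose
  values outside \<open>(0,\<infinity>)\<close> are unconstrained; bodies in \<open>convex_bodies_o\<close> have
  a positive support function on the sphere, so these values are never used.\<close>

definition increasing_class :: "(real \<Rightarrow> real) set" where
  "increasing_class = {\<phi>.
     (\<forall>t>0. \<phi> t > 0) \<and>
     continuous_on {0<..} \<phi> \<and>
     strict_mono_on {0<..} \<phi> \<and>
     (\<phi> \<longlongrightarrow> 0) (at_right 0) \<and>
     \<phi> 1 = 1 \<and>
     filterlim \<phi> at_top at_top}"

definition sphere_measures :: "(real ^ 'n) measure set" where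
  "sphere_measures = {\<mu>.
     sets \<mu> = sets (restrict_space borel (sphere 0 1)) \<and>
     finite_measure \<mu> \<and>
     emeasure \<mu> (space \<mu>) \<noteq> 0 \<and>
     (\<forall>v\<in>sphere 0 1. (\<integral>u. max (u \<bullet> v) 0 \<partial>\<mu>) > 0)}"

text \<open>For \<open>\<phi> \<in> increasing_class\<close>, \<open>\<mu> \<in> sphere_measures\<close> and \<open>L \<in> convex_bodies_o\<close> the integrand is
  continuous and positive on the sphere, so the Bochner integral is a genuine one.\<close>

definition orlicz_functional ::
  "(real ^ 'n) measure \<Rightarrow> (real \<Rightarrow> real) \<Rightarrow> (real ^ 'n) set \<Rightarrow> real" where
  "orlicz_functional \<mu> \<phi> L = (\<integral>u. \<phi> (support_fun L u) \<partial>\<mu>)"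

end

theory Submission
  imports Defs "HOL-Probability.Distributions" "HOL-Complex_Analysis.Great_Picard"
begin

text \<open>Bodies are handled through sublinear functions \<open>h\<close> with \<open>a * norm x \<le> h x \<le> b * norm x\<close>:
  such an \<open>h\<close> is the support function of its Wulff body, whose polar is the sublevel set
  \<open>{h \<le> 1}\<close>. By the layer-cake formula, \<open>\<integral> exp (- h) = n! |{h \<le> 1}|\<close>. This makes the
  polar volume continuous under pointwise convergence of support functions (dominated
  convergence), and strict convexity of \<open>exp\<close> shows that the Minkowski midpoint of two distinct
  normalized bodies has a polar of strictly smaller volume.

  Existence: along a minimizing sequence the bodies are bounded, because \<open>\<mu>\<close> is not concentrated
  on a hemisphere and \<open>\<phi>\<close> is unbounded. Their polars contain a fixed ball and have fixed volume,
  so they are bounded too; Arzela-Ascoli then yields a limit of the support functions.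
  Uniqueness: for convex \<open>\<phi>\<close> the midpoint of two distinct minimizers has functional at most the
  infimum, and shrinking it until its polar has the right volume lowers the functional strictly.\<close>

section \<open>Sublinear functions\<close>

text \<open>On \<open>real ^ 'n\<close> with 0 < a these are the support functions of the convex
  bodies between the balls of radius a and b about 0. Keeping a and b as parameters lets a whole
  sequence share its bounds.\<close>

definition sublinear_between :: "real \<Rightarrow> real \<Rightarrow> ('a::real_normed_vector \<Rightarrow> real) \<Rightarrow> bool" where
  "sublinear_between a b h \<longleftrightarrow>
     (\<forall>x y. h (x + y) \<le> h x + h y) \<and>
     (\<forall>c x. 0 \<le> c \<longrightarrow> h (c *\<^sub>R x) = c * h x) \<and>
     (\<forall>x. a * norm x \<le> h x \<and> h x \<le> b * norm x)"

lemma sublinear_betweenD: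
  assumes "sublinear_between a b h"
  shows "h (x + y) \<le> h x + h y" and "0 \<le> c \<Longrightarrow> h (c *\<^sub>R x) = c * h x"
    and "a * norm x \<le> h x" and "h x \<le> b * norm x" and "h 0 = 0"
proof -
  show "h (x + y) \<le> h x + h y" and "0 \<le> c \<Longrightarrow> h (c *\<^sub>R x) = c * h x"
    and bd: "a * norm x \<le> h x" "h x \<le> b * norm x" for x y c
    using assms by (auto simp: sublinear_between_def)
  show "h 0 = 0"
    using bd[of 0] by simp
qed

lemma sublinear_between_nonneg:
  assumes "sublinear_between a b h" "0 < a"
  shows "0 \<le> h x"
  using sublinear_betweenD(3)[OF assms(1), of x] assms(2)
  by (meson less_imp_le mult_nonneg_nonneg norm_ge_zero order_trans)

lemma sublinear_between_pos:
  assumes "sublinear_between a b h" "0 < a" "x \<noteq> 0"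
  shows "0 < h x"
  using sublinear_betweenD(3)[OF assms(1), of x] assms(2,3)
  by (meson mult_pos_pos zero_less_norm_iff less_le_trans)

lemma sublinear_between_lipschitz:
  fixes h :: "'a::real_normed_vector \<Rightarrow> real"
  assumes "sublinear_between a b h"
  shows "\<bar>h x - h y\<bar> \<le> b * norm (x - y)"
proof -
  have *: "h x - h y \<le> b * norm (x - y)" for x y :: 'a
    using sublinear_betweenD(1)[OF assms, of y "x - y"] sublinear_betweenD(4)[OF assms, of "x - y"] by simp
  show ?thesis
    using *[of x y] *[of y x] by (simp add: abs_le_iff norm_minus_commute)
qed

lemma sublinear_between_continuous_on:
  fixes h :: "'a::real_normed_vector \<Rightarrow> real"
  assumes "sublinear_between a b h"
  shows "continuous_on S h"
proof -
  \<comment> \<open>A Lipschitz constant must be nonnegative, and the sign of b is not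
    assumed.\<close>
  have "(\<bar>b\<bar>)-lipschitz_on S h"
  proof (rule lipschitz_onI)
    fix x y :: 'a
    have "b * norm (x - y) \<le> \<bar>b\<bar> * norm (x - y)"
      by (intro mult_right_mono) auto
    then show "dist (h x) (h y) \<le> \<bar>b\<bar> * dist x y"
      using sublinear_between_lipschitz[OF assms, of x y] by (simp add: dist_norm)
  qed simp
  then show ?thesis by (rule lipschitz_on_continuous_on)
qed

lemma sublinear_between_measurable:
  fixes h :: "'a::{real_normed_vector,second_countable_topology} \<Rightarrow> real"
  assumes "sublinear_between a b h"
  shows "h \<in> borel_measurable borel"
  by (intro borel_measurable_continuous_onI sublinear_between_continuous_on[OF assms])

lemma sublinear_between_scale:
  assumes "sublinear_between a b h" "0 \<le> c"
  shows "sublinear_between (c * a) (c * b) (\<lambda>x. c * h x)"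
  unfolding sublinear_between_def
proof (intro conjI allI impI)
  fix x y
  show "c * h (x + y) \<le> c * h x + c * h y"
    using mult_left_mono[OF sublinear_betweenD(1)[OF assms(1)] assms(2)] by (simp add: distrib_left)
  show "c * a * norm x \<le> c * h x" "c * h x \<le> c * b * norm x"
    using mult_left_mono[OF sublinear_betweenD(3)[OF assms(1)] assms(2)]
      mult_left_mono[OF sublinear_betweenD(4)[OF assms(1)] assms(2)] by (simp_all add: mult.assoc)
next
  fix d :: real and x assume "0 \<le> d"
  then show "c * h (d *\<^sub>R x) = d * (c * h x)"
    by (simp add: sublinear_betweenD(2)[OF assms(1)])
qed

lemma sublinear_between_add:
  assumes "sublinear_between a b h" "sublinear_between a' b' k"
  shows "sublinear_between (a + a') (b + b') (\<lambda>x. h x + k x)"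
  unfolding sublinear_between_def
proof (intro conjI allI impI)
  fix x y
  show "h (x + y) + k (x + y) \<le> h x + k x + (h y + k y)"
    using sublinear_betweenD(1)[OF assms(1), of x y] sublinear_betweenD(1)[OF assms(2), of x y] by simp
  show "(a + a') * norm x \<le> h x + k x" "h x + k x \<le> (b + b') * norm x"
    using sublinear_betweenD(3,4)[OF assms(1), of x] sublinear_betweenD(3,4)[OF assms(2), of x]
    by (auto simp: distrib_right)
next
  fix c :: real and x assume "0 \<le> c"
  then show "h (c *\<^sub>R x) + k (c *\<^sub>R x) = c * (h x + k x)"
    by (simp add: sublinear_betweenD(2)[OF assms(1)] sublinear_betweenD(2)[OF assms(2)] distrib_left)
qed

lemma sublinear_between_tendsto:
  assumes "\<And>n. sublinear_between a b (h n)" "\<And>x. (\<lambda>n. h n x) \<longlonglongrightarrow> k x"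
  shows "sublinear_between a b k"
  unfolding sublinear_between_def
proof (intro conjI allI impI)
  fix x y
  show "k (x + y) \<le> k x + k y"
    by (rule LIMSEQ_le[OF assms(2) tendsto_add[OF assms(2) assms(2)]])
      (use sublinear_betweenD(1)[OF assms(1)] in auto)
  show "a * norm x \<le> k x" "k x \<le> b * norm x"
    by (rule LIMSEQ_le_const[OF assms(2)] LIMSEQ_le_const2[OF assms(2)];
        use sublinear_betweenD(3,4)[OF assms(1)] in auto)+
next
  fix c :: real and x assume "0 \<le> c"
  then have "(\<lambda>n. h n (c *\<^sub>R x)) = (\<lambda>n. c * h n x)"
    by (intro ext sublinear_betweenD(2)[OF assms(1)])
  then show "k (c *\<^sub>R x) = c * k x"
    using LIMSEQ_unique[OF assms(2)[of "c *\<^sub>R x"]] tendsto_mult_left[OF assms(2), of c x] by simp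
qed

lemma sublinear_between_mono:
  assumes "sublinear_between a b h" "a' \<le> a" "b \<le> b'"
  shows "sublinear_between a' b' h"
  using assms unfolding sublinear_between_def
  by (meson mult_right_mono norm_ge_zero order_trans)

lemma sublinear_between_sphere:
  assumes "sublinear_between a b h" "u \<in> sphere 0 1"
  shows "a \<le> h u" "h u \<le> b"
  using sublinear_betweenD(3,4)[OF assms(1), of u] assms(2) by simp_all

section \<open>Compactness of uniformly bounded families\<close>

text \<open>Functional counterpart of Blaschke selection. The common Lipschitz bound gives
  equicontinuity, so Arzela-Ascoli applies on the sphere; homogeneity carries the convergence to the
  whole space.\<close>

lemma sublinear_between_convergent_subseq:
  fixes h :: "nat \<Rightarrow> 'a::euclidean_space \<Rightarrow> real"
  assumes h: "\<And>n. sublinear_between a b (h n)"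
  obtains k r where "strict_mono (r :: nat \<Rightarrow> nat)" "\<And>x. (\<lambda>n. h (r n) x) \<longlonglongrightarrow> k x"
proof -
  have "\<exists>d>0. \<forall>n y. y \<in> sphere 0 1 \<and> norm (x - y) < d \<longrightarrow> norm (h n x - h n y) < e"
    if "0 < e" for x and e :: real
  proof (intro exI conjI allI impI)
    show "0 < e / (\<bar>b\<bar> + 1)" using that by simp
    fix n y assume "y \<in> sphere 0 1 \<and> norm (x - y) < e / (\<bar>b\<bar> + 1)"
    then have lt: "norm (x - y) * (\<bar>b\<bar> + 1) < e"
      by (simp add: pos_less_divide_eq)
    have "norm (h n x - h n y) \<le> b * norm (x - y)"
      using sublinear_between_lipschitz[OF h] by simp
    also have "\<dots> \<le> norm (x - y) * (\<bar>b\<bar> + 1)"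
      by (subst mult.commute) (intro mult_left_mono, auto)
    finally show "norm (h n x - h n y) < e" using lt by simp
  qed
  moreover have "norm (h n x) \<le> \<bar>a\<bar> + \<bar>b\<bar>" if "x \<in> sphere 0 1" for n x
    using sublinear_between_sphere[OF h that, of n] by (simp add: abs_le_iff) linarith
  ultimately obtain g and r :: "nat \<Rightarrow> nat" where "strict_mono r"
    and g: "\<And>e. 0 < e \<Longrightarrow> \<exists>N. \<forall>n x. n \<ge> N \<and> x \<in> sphere 0 1 \<longrightarrow> norm (h (r n) x - g x) < e"
    using Arzela_Ascoli[of "sphere 0 1" h "\<bar>a\<bar> + \<bar>b\<bar>"] compact_sphere by metis
  \<comment> \<open>The limit g is controlled on the sphere only, so it is extended by homogeneity;
    at 0 the factor \<open>norm x\<close> removes the value of g.\<close>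
  have lim: "(\<lambda>n. h (r n) x) \<longlonglongrightarrow> norm x * g (sgn x)" for x
  proof (cases "x = 0")
    case False
    have "(\<lambda>n. h (r n) (sgn x)) \<longlonglongrightarrow> g (sgn x)"
    proof (rule LIMSEQ_I)
      fix e :: real assume "0 < e"
      moreover have "sgn x \<in> sphere 0 1"
        using False by (simp add: norm_sgn)
      ultimately show "\<exists>N. \<forall>n\<ge>N. norm (h (r n) (sgn x) - g (sgn x)) < e"
        using g by meson
    qed
    then have "(\<lambda>n. norm x * h (r n) (sgn x)) \<longlonglongrightarrow> norm x * g (sgn x)"
      by (rule tendsto_mult_left)
    moreover have "norm x * h (r n) (sgn x) = h (r n) x" for n
      using sublinear_betweenD(2)[OF h, of "norm x" "r n" "sgn x"] False by (simp add: sgn_div_norm)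
    ultimately show ?thesis by simp
  qed (simp add: sublinear_betweenD(5)[OF h])
  show ?thesis
    by (rule that[OF \<open>strict_mono r\<close> lim])
qed

section \<open>Sublevel sets\<close>

lemma sublevel_props:
  fixes h :: "'a::euclidean_space \<Rightarrow> real"
  assumes h: "sublinear_between a b h" and "0 < a"
  shows "compact {x. h x \<le> t}" and "convex {x. h x \<le> t}"
proof -
  have "closed {x. h x \<le> t}"
    using sublinear_between_continuous_on[OF h] by (intro closed_Collect_le) auto
  moreover have "{x. h x \<le> t} \<subseteq> cball 0 (t / a)"
  proof
    fix x assume "x \<in> {x. h x \<le> t}"
    then have "a * norm x \<le> t"
      using sublinear_betweenD(3)[OF h, of x] by simp
    then show "x \<in> cball 0 (t / a)"
      using \<open>0 < a\<close> by (simp add: field_simps)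
  qed
  ultimately show "compact {x. h x \<le> t}"
    using bounded_cball bounded_subset compact_eq_bounded_closed by blast
  show "convex {x. h x \<le> t}"
  proof (rule convexI)
    fix x y and u v :: real
    assume *: "x \<in> {x. h x \<le> t}" "y \<in> {x. h x \<le> t}" "0 \<le> u" "0 \<le> v" "u + v = 1"
    have "h (u *\<^sub>R x + v *\<^sub>R y) \<le> u * h x + v * h y"
      using sublinear_betweenD(1)[OF h, of "u *\<^sub>R x" "v *\<^sub>R y"] * by (simp add: sublinear_betweenD(2)[OF h])
    also have "\<dots> \<le> u * t + v * t"
      using * by (intro add_mono mult_left_mono) auto
    also have "\<dots> = t"
      using * by (simp flip: distrib_right)
    finally show "u *\<^sub>R x + v *\<^sub>R y \<in> {x. h x \<le> t}" by simp
  qed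
qed

text \<open>By homogeneity {h <= t} is the dilate by t of {h <= 1}.\<close>

lemma sublevel_measure_scale:
  fixes h :: "'a::euclidean_space \<Rightarrow> real"
  assumes h: "sublinear_between a b h" and "0 < t"
  shows "emeasure lborel {x. h x \<le> t} = ennreal (t ^ DIM('a)) * emeasure lborel {x. h x \<le> 1}"
proof -
  note [measurable] = sublinear_between_measurable[OF h]
  have eq: "(\<lambda>x. t *\<^sub>R x) -` {x. h x \<le> t} = {x. h x \<le> 1}"
    using \<open>0 < t\<close> by (auto simp: sublinear_betweenD(2)[OF h])
  have "emeasure lborel {x. h x \<le> t}
      = emeasure (density (distr lborel borel (\<lambda>x. 0 + t *\<^sub>R x)) (\<lambda>_. \<bar>t\<bar> ^ DIM('a))) {x. h x \<le> t}"
    using lborel_affine[of t "0::'a"] \<open>0 < t\<close> by simp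
  also have "\<dots> = ennreal (t ^ DIM('a)) * emeasure lborel {x. h x \<le> 1}"
    using \<open>0 < t\<close> eq by (simp add: emeasure_density nn_integral_cmult_indicator emeasure_distr vimage_def)
  finally show ?thesis .
qed

section \<open>Volume as an exponential integral\<close>

text \<open>Layer cake: \<open>exp (- h x)\<close> is the integral of \<open>exp (- t)\<close> over
  t >= h x. Exchanging the integrals and using the scaling of sublevel sets leaves the Gamma
  integral of t^n exp(-t), which is n!, times the volume.\<close>

lemma nn_integral_exp_minus:
  fixes h :: "'a::euclidean_space \<Rightarrow> real"
  assumes h: "sublinear_between a b h" and "0 < a"
  shows "(\<integral>\<^sup>+x. ennreal (exp (- h x)) \<partial>lborel) = ennreal (fact (DIM('a))) * emeasure lborel {x. h x \<le> 1}"
proof -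
  note [measurable] = sublinear_between_measurable[OF h]
  let ?V = "emeasure lborel {x. h x \<le> 1}"
  have layer: "ennreal (exp (- s)) = (\<integral>\<^sup>+t. ennreal (exp (- t)) * indicator {s..} t \<partial>lborel)" for s :: real
  proof -
    have "(\<integral>\<^sup>+t. ennreal (exp (- t)) * indicator {s..} t \<partial>lborel) = ennreal (0 - (- exp (- s)))"
    proof (rule nn_integral_FTC_atLeast)
      show "((\<lambda>x. - exp (- x)) \<longlongrightarrow> (0::real)) at_top"
        using tendsto_minus[OF filterlim_compose[OF exp_at_bot filterlim_uminus_at_bot_at_top]] by simp
    qed (auto intro!: derivative_eq_intros)
    then show ?thesis by simp
  qed
  have meas: "(\<lambda>(x, t). ennreal (exp (- t)) * indicator {x. h x \<le> t} x) \<in> borel_measurable (lborel \<Otimes>\<^sub>M lborel)"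
    unfolding indicator_def by measurable
  have "(\<integral>\<^sup>+x. ennreal (exp (- h x)) \<partial>lborel)
      = (\<integral>\<^sup>+x. \<integral>\<^sup>+t. ennreal (exp (- t)) * indicator {x. h x \<le> t} x \<partial>lborel \<partial>lborel)"
  proof (rule nn_integral_cong)
    fix x :: 'a
    have "indicator {h x..} t = (indicator {x. h x \<le> t} x :: ennreal)" for t
      by (simp add: indicator_def)
    then show "ennreal (exp (- h x)) = (\<integral>\<^sup>+t. ennreal (exp (- t)) * indicator {x. h x \<le> t} x \<partial>lborel)"
      using layer[of "h x"] by simp
  qed
  also have "\<dots> = (\<integral>\<^sup>+t. \<integral>\<^sup>+x. ennreal (exp (- t)) * indicator {x. h x \<le> t} x \<partial>lborel \<partial>lborel)"
    by (rule lborel_pair.Fubini'[OF meas, symmetric])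
  also have "\<dots> = (\<integral>\<^sup>+t. ennreal (t ^ DIM('a) * exp (- t)) * indicator {0..} t * ?V \<partial>lborel)"
  \<comment> \<open>The null set t = 0 is dropped: the scaling law covers t > 0, and for t < 0 the
    sublevel set is empty.\<close>
  proof (rule nn_integral_cong_AE, use AE_lborel_singleton[of "0::real"] in eventually_elim)
    fix t :: real assume "t \<noteq> 0"
    have "(\<integral>\<^sup>+x. ennreal (exp (- t)) * indicator {x. h x \<le> t} x \<partial>lborel)
        = ennreal (exp (- t)) * emeasure lborel {x. h x \<le> t}"
      by (rule nn_integral_cmult_indicator) simp
    also have "\<dots> = ennreal (t ^ DIM('a) * exp (- t)) * indicator {0..} t * ?V"
    proof (cases "0 < t")
      case True
      then show ?thesis
        by (subst sublevel_measure_scale[OF h True]) (simp add: ennreal_mult' mult_ac)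
    next
      case False
      then have "{x. h x \<le> t} = {}"
        using \<open>t \<noteq> 0\<close> sublinear_between_nonneg[OF h \<open>0 < a\<close>]
        by (auto simp: not_le intro: less_le_trans[of t 0])
      then show ?thesis using False \<open>t \<noteq> 0\<close> by simp
    qed
    finally show "(\<integral>\<^sup>+x. ennreal (exp (- t)) * indicator {x. h x \<le> t} x \<partial>lborel)
        = ennreal (t ^ DIM('a) * exp (- t)) * indicator {0..} t * ?V" .
  qed
  also have "\<dots> = (\<integral>\<^sup>+t. ennreal (t ^ DIM('a) * exp (- t)) * indicator {0..} t \<partial>lborel) * ?V"
    by (rule nn_integral_multc) measurable
  also have "\<dots> = ennreal (fact (DIM('a))) * ?V"
    by (subst nn_intergal_power_times_exp_Ici) simp
  finally show ?thesis .
qed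

lemma integral_exp_minus:
  fixes h :: "'a::euclidean_space \<Rightarrow> real"
  assumes h: "sublinear_between a b h" and "0 < a"
  shows "integrable lborel (\<lambda>x. exp (- h x))"
    and "(\<integral>x. exp (- h x) \<partial>lborel) = fact (DIM('a)) * measure lborel {x. h x \<le> 1}"
proof -
  note [measurable] = sublinear_between_measurable[OF h]
  have "emeasure lborel {x. h x \<le> 1} < \<infinity>"
    by (intro emeasure_bounded_finite compact_imp_bounded sublevel_props[OF h \<open>0 < a\<close>])
  then have fin: "emeasure lborel {x. h x \<le> 1} \<noteq> top"
    by simp
  have eq: "(\<integral>\<^sup>+x. ennreal (exp (- h x)) \<partial>lborel) = ennreal (fact (DIM('a)) * measure lborel {x. h x \<le> 1})"
    unfolding nn_integral_exp_minus[OF h \<open>0 < a\<close>] emeasure_eq_ennreal_measure[OF fin]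
    by (rule ennreal_mult'[symmetric]) simp
  show "integrable lborel (\<lambda>x. exp (- h x))"
    by (rule integrableI_nonneg) (auto simp: eq)
  show "(\<integral>x. exp (- h x) \<partial>lborel) = fact (DIM('a)) * measure lborel {x. h x \<le> 1}"
    by (subst integral_eq_nn_integral) (auto simp: eq)
qed

text \<open>The exponential formula turns convergence of volumes into convergence of integrals. The
  common lower bound supplies the majorant \<open>exp (- (a * norm x))\<close>, integrable by the
  same formula applied to \<open>a * norm x\<close>.\<close>

lemma sublevel_measure_tendsto:
  fixes h :: "nat \<Rightarrow> 'a::euclidean_space \<Rightarrow> real"
  assumes h: "\<And>n. sublinear_between a b (h n)" and "0 < a"
    and lim: "\<And>x. (\<lambda>n. h n x) \<longlonglongrightarrow> k x"
  shows "(\<lambda>n. measure lborel {x. h n x \<le> 1}) \<longlonglongrightarrow> measure lborel {x. k x \<le> 1}"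
proof -
  have k: "sublinear_between a b k"
    by (rule sublinear_between_tendsto[OF h lim])
  have nrm: "sublinear_between a a (\<lambda>x::'a. a * norm x)"
    using \<open>0 < a\<close> by (auto simp: sublinear_between_def norm_triangle_ineq simp flip: distrib_left)
  have "(\<lambda>n. \<integral>x. exp (- h n x) \<partial>lborel) \<longlonglongrightarrow> (\<integral>x. exp (- k x) \<partial>lborel)"
  proof (rule integral_dominated_convergence)
    show "integrable lborel (\<lambda>x::'a. exp (- (a * norm x)))"
      by (rule integral_exp_minus(1)[OF nrm \<open>0 < a\<close>])
    show "AE x in lborel. (\<lambda>n. exp (- h n x)) \<longlonglongrightarrow> exp (- k x)"
      by (intro AE_I2 tendsto_intros lim)
    show "AE x in lborel. norm (exp (- h n x)) \<le> exp (- (a * norm x))" for n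
      using sublinear_betweenD(3)[OF h] by (intro AE_I2) auto
  qed (use sublinear_between_measurable[OF h] sublinear_between_measurable[OF k] in measurable)
  then have "(\<lambda>n. (\<integral>x. exp (- h n x) \<partial>lborel) / fact (DIM('a))) \<longlonglongrightarrow> (\<integral>x. exp (- k x) \<partial>lborel) / fact (DIM('a))"
    by (intro tendsto_divide tendsto_const) auto
  then show ?thesis
    by (simp add: integral_exp_minus(2)[OF h \<open>0 < a\<close>] integral_exp_minus(2)[OF k \<open>0 < a\<close>])
qed

section \<open>Midpoint inequality for sublevel volumes\<close>

lemma exp_midpoint:
  fixes s t :: real
  shows "exp (- ((s + t) / 2)) \<le> (exp (- s) + exp (- t)) / 2"
    and "exp (- ((s + t) / 2)) = (exp (- s) + exp (- t)) / 2 \<Longrightarrow> s = t"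
proof -
  \<comment> \<open>The convexity defect is half a perfect square, which yields both the inequality
    and its equality case.\<close>
  have *: "(exp (- s) + exp (- t)) / 2 - exp (- ((s + t) / 2)) = (exp (- s / 2) - exp (- t / 2))\<^sup>2 / 2"
    by (simp add: power2_eq_square field_simps flip: exp_add)
  show "exp (- ((s + t) / 2)) \<le> (exp (- s) + exp (- t)) / 2"
    using * by (smt (verit) zero_le_power2 divide_nonneg_nonneg)
  show "s = t" if "exp (- ((s + t) / 2)) = (exp (- s) + exp (- t)) / 2"
    using * that by simp
qed

text \<open>Integrating \<open>exp_midpoint\<close> pointwise compares the exponential integrals,
  hence the volumes. In the equality case the nonnegative defect has integral 0, so h = k almost
  everywhere, and continuity removes the exceptional set.\<close>

lemma sublevel_measure_midpoint:
  fixes h k :: "'a::euclidean_space \<Rightarrow> real"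
  assumes h: "sublinear_between a b h" and k: "sublinear_between a b k" and "0 < a"
    and hV: "measure lborel {x. h x \<le> 1} = V" and kV: "measure lborel {x. k x \<le> 1} = V"
  shows "measure lborel {x. (h x + k x) / 2 \<le> 1} \<le> V"
    and "measure lborel {x. (h x + k x) / 2 \<le> 1} = V \<Longrightarrow> h = k"
proof -
  let ?q = "\<lambda>x. (h x + k x) / 2"
  have q: "sublinear_between a b ?q"
    using sublinear_between_scale[OF sublinear_between_add[OF h k], of "1/2"] by simp
  note int = integral_exp_minus(1)[OF h \<open>0 < a\<close>] integral_exp_minus(1)[OF k \<open>0 < a\<close>] integral_exp_minus(1)[OF q \<open>0 < a\<close>]
  note eq = integral_exp_minus(2)[OF h \<open>0 < a\<close>] integral_exp_minus(2)[OF k \<open>0 < a\<close>] integral_exp_minus(2)[OF q \<open>0 < a\<close>]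
  have avg: "(\<integral>x. (exp (- h x) + exp (- k x)) / 2 \<partial>lborel) = fact (DIM('a)) * V"
    using int by (simp add: eq hV kV)
  have "(\<integral>x. exp (- ?q x) \<partial>lborel) \<le> (\<integral>x. (exp (- h x) + exp (- k x)) / 2 \<partial>lborel)"
    using int exp_midpoint(1) by (intro integral_mono) auto
  then show "measure lborel {x. ?q x \<le> 1} \<le> V"
    unfolding avg eq by simp
  assume qV: "measure lborel {x. ?q x \<le> 1} = V"
  let ?d = "\<lambda>x. (exp (- h x) + exp (- k x)) / 2 - exp (- ?q x)"
  have d0: "0 \<le> ?d x" for x
    using exp_midpoint(1)[of "h x" "k x"] by simp
  have "(\<integral>x. ?d x \<partial>lborel)
      = (\<integral>x. (exp (- h x) + exp (- k x)) / 2 \<partial>lborel) - (\<integral>x. exp (- ?q x) \<partial>lborel)"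
    using int by (intro Bochner_Integration.integral_diff) auto
  then have "(\<integral>x. ?d x \<partial>lborel) = 0"
    unfolding avg eq(3) qV by simp
  then have "AE x in lborel. ?d x = 0"
    using int d0 by (subst (asm) integral_nonneg_eq_0_iff_AE) auto
  then have "AE x in lborel. h x = k x"
  proof eventually_elim
    fix x assume "?d x = 0"
    then have "exp (- ?q x) = (exp (- h x) + exp (- k x)) / 2"
      by linarith
    then show "h x = k x"
      by (rule exp_midpoint(2))
  qed
  then have ae: "AE x in lebesgue. x \<in> {x. h x = k x}"
    by (simp add: AE_completion)
  \<comment> \<open>A closed set of full Lebesgue measure is the whole space.\<close>
  have "closed {x. h x = k x}"
    by (intro closed_Collect_eq sublinear_between_continuous_on[OF h] sublinear_between_continuous_on[OF k])
  then have "x \<in> {x. h x = k x}" for x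
    using mem_closed_if_AE_lebesgue[OF _ ae] by blast
  then show "h = k" by auto
qed

text \<open>If \<open>y\<close> lies in a convex set \<open>K\<close> containing the ball of radius \<open>r\<close>, then \<open>K\<close>
  contains balls of radius \<open>r / 2\<close> about all points of the first half of the segment from \<open>0\<close> to
  \<open>y\<close>; roughly \<open>norm y / (2 * r)\<close> of them can be packed disjointly.\<close>

lemma convex_measure_ge_norm:
  fixes K :: "'a::euclidean_space set"
  assumes "convex K" "compact K" "ball 0 r \<subseteq> K" "0 < r" "y \<in> K"
  shows "norm y * measure lborel (ball (0::'a) (r / 2)) \<le> 2 * r * measure lborel K"
proof (cases "y = 0")
  case False
  \<comment> \<open>For k <= N the centres below stay in the first half of the segment; the N + 1
    balls, counted from k = 0, make up for the rounding in the floor.\<close>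
  define N where "N = nat \<lfloor>norm y / (2 * r)\<rfloor>"
  \<comment> \<open>Consecutive centres are r apart, so the open balls of radius r / 2 are
    disjoint.\<close>
  define c where "c k = (real k * r / norm y) *\<^sub>R y" for k
  have N: "real N \<le> norm y / (2 * r)" "norm y / (2 * r) \<le> real N + 1"
    unfolding N_def using \<open>0 < r\<close> by (simp add: of_nat_floor, linarith)
  have sub: "ball (c k) (r / 2) \<subseteq> K" if "k \<le> N" for k
  proof
    fix z assume z: "z \<in> ball (c k) (r / 2)"
    define t where "t = real k * r / norm y"
    have "real k \<le> norm y / (2 * r)"
      using N(1) that by linarith
    then have t: "0 \<le> t" "t \<le> 1 / 2"
      using \<open>0 < r\<close> False by (auto simp: t_def field_simps)
    \<comment> \<open>Solves z = t y + (1 - t) w. As t <= 1/2, w stays in the ball of radius r, and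
      convexity puts z into K.\<close>
    define w where "w = (1 / (1 - t)) *\<^sub>R (z - c k)"
    have "norm (z - c k) < r / 2"
      using z by (simp add: dist_norm norm_minus_commute)
    also have "\<dots> \<le> r * (1 - t)"
      using t \<open>0 < r\<close> by (simp add: field_simps)
    finally have "norm (z - c k) / (1 - t) < r"
      using t by (simp add: divide_less_eq)
    then have "norm w < r"
      using t by (simp add: w_def)
    then have "w \<in> K"
      using assms(3) by auto
    then have "t *\<^sub>R y + (1 - t) *\<^sub>R w \<in> K"
      using assms(1,5) t by (intro convexD) auto
    also have "t *\<^sub>R y + (1 - t) *\<^sub>R w = z"
      using t by (simp add: w_def c_def t_def[symmetric])
    finally show "z \<in> K" .
  qed
  have "disjoint_family_on (\<lambda>k. ball (c k) (r / 2)) {..N}"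
    unfolding disjoint_family_on_def
  proof (intro ballI impI)
    fix j k :: nat assume "j \<noteq> k"
    then have "1 \<le> \<bar>real j - real k\<bar>" by linarith
    then have "r \<le> \<bar>real j - real k\<bar> * r"
      using \<open>0 < r\<close> by simp
    also have "\<dots> = \<bar>real j * r / norm y - real k * r / norm y\<bar> * norm y"
      using False \<open>0 < r\<close> by (simp add: abs_mult flip: left_diff_distrib diff_divide_distrib)
    also have "\<dots> = dist (c j) (c k)"
      by (simp add: c_def dist_norm flip: scaleR_left_diff_distrib)
    finally have *: "r \<le> dist (c j) (c k)" .
    show "ball (c j) (r / 2) \<inter> ball (c k) (r / 2) = {}"
      by (rule disjoint_ballI) (use * in simp)
  qed
  then have "measure lborel (\<Union>k\<in>{..N}. ball (c k) (r / 2)) = (\<Sum>k\<le>N. measure lborel (ball (c k) (r / 2)))"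
    by (intro measure_finite_Union) (use emeasure_bounded_finite[OF bounded_ball] in \<open>auto simp: less_top[symmetric]\<close>)
  also have "\<dots> = (real N + 1) * measure lborel (ball (0::'a) (r / 2))"
    using \<open>0 < r\<close> by (simp add: content_ball add.commute)
  finally have eq: "measure lborel (\<Union>k\<in>{..N}. ball (c k) (r / 2)) = (real N + 1) * measure lborel (ball (0::'a) (r / 2))" .
  have "norm y / (2 * r) * measure lborel (ball (0::'a) (r / 2)) \<le> (real N + 1) * measure lborel (ball (0::'a) (r / 2))"
    using N by (intro mult_right_mono) auto
  also have "\<dots> \<le> measure lborel K"
    unfolding eq[symmetric]
  proof (rule measure_mono_fmeasurable)
    show "K \<in> fmeasurable lborel"
      using \<open>compact K\<close> by (rule fmeasurable_compact)
  qed (use sub in auto)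
  finally show ?thesis
    using \<open>0 < r\<close> by (simp add: field_simps)
qed (use assms in simp)

lemma ball_subset_sublevel:
  fixes h :: "'a::real_normed_vector \<Rightarrow> real"
  assumes h: "sublinear_between a b h" and "0 < b"
  shows "ball 0 (1 / b) \<subseteq> {x. h x \<le> 1}"
proof
  fix x :: 'a assume "x \<in> ball 0 (1 / b)"
  then have "b * norm x \<le> 1"
    using \<open>0 < b\<close> by (simp add: field_simps)
  then show "x \<in> {x. h x \<le> 1}"
    using sublinear_betweenD(4)[OF h, of x] by simp
qed

lemma sublevel_measure_pos:
  fixes h :: "'a::euclidean_space \<Rightarrow> real"
  assumes h: "sublinear_between a b h" and "0 < a" "0 < b"
  shows "0 < measure lborel {x. h x \<le> 1}"
proof -
  have "0 < measure lborel (ball (0::'a) (1 / b))"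
    using \<open>0 < b\<close> by (simp add: content_ball)
  also have "\<dots> \<le> measure lborel {x. h x \<le> 1}"
    using ball_subset_sublevel[OF h \<open>0 < b\<close>] fmeasurable_compact[OF sublevel_props(1)[OF h \<open>0 < a\<close>]]
    by (intro measure_mono_fmeasurable) auto
  finally show ?thesis .
qed

text \<open>The new lower bound depends on a only through its positivity: it comes from b and the
  volume. The sublevel set contains the ball of radius 1/b, so a volume bound keeps all its points
  within distance D of 0; by polarity this is an inner radius 1/D.\<close>

lemma sublinear_between_of_measure:
  fixes h :: "'a::euclidean_space \<Rightarrow> real"
  assumes h: "sublinear_between a b h" and "0 < a" "0 < b"
    and D: "2 * measure lborel {x. h x \<le> 1} \<le> D * (b * measure lborel (ball (0::'a) (1 / (2 * b))))" "0 < D"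
  shows "sublinear_between (1 / D) b h"
proof -
  let ?v = "measure lborel (ball (0::'a) (1 / (2 * b)))"
  have "0 < ?v"
    using \<open>0 < b\<close> by (simp add: content_ball)
  have "1 / D * norm x \<le> h x" for x
  proof (cases "x = 0")
    case False
    then have pos: "0 < h x"
      by (rule sublinear_between_pos[OF h \<open>0 < a\<close>])
    \<comment> \<open>The point with h y = 1 on the ray through x; norm y <= D is the claimed bound
      at x.\<close>
    define y where "y = (1 / h x) *\<^sub>R x"
    have "y \<in> {x. h x \<le> 1}"
      using pos by (simp add: y_def sublinear_betweenD(2)[OF h])
    then have "norm y * measure lborel (ball (0::'a) (1 / b / 2)) \<le> 2 * (1 / b) * measure lborel {x. h x \<le> 1}"
      using sublevel_props[OF h \<open>0 < a\<close>] ball_subset_sublevel[OF h \<open>0 < b\<close>] \<open>0 < b\<close>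
      by (intro convex_measure_ge_norm) auto
    then have "norm y * (b * ?v) \<le> 2 * measure lborel {x. h x \<le> 1}"
      using \<open>0 < b\<close> by (simp add: field_simps)
    also note D(1)
    finally have "norm y \<le> D"
      using \<open>0 < ?v\<close> \<open>0 < b\<close> by simp
    then show ?thesis
      using pos \<open>0 < D\<close> by (simp add: y_def field_simps)
  qed (simp add: sublinear_betweenD(5)[OF h])
  then show ?thesis
    using h by (simp add: sublinear_between_def)
qed

section \<open>Support functions and Wulff bodies\<close>

lemma support_fun_upper:
  assumes "compact L" "x \<in> L"
  shows "x \<bullet> u \<le> support_fun L u"
  using support_fun_attained[OF assms(1), of u] assms(2) by (metis empty_iff)

lemma support_fun_least:
  assumes "L \<noteq> {}" "\<And>x. x \<in> L \<Longrightarrow> x \<bullet> u \<le> c"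
  shows "support_fun L u \<le> c"
  unfolding support_fun_def using assms by (rule cSUP_least)

lemma sublinear_between_support_fun:
  fixes L :: "(real ^ 'n) set"
  assumes "compact L" "cball 0 a \<subseteq> L" "L \<subseteq> cball 0 b" "0 \<le> a"
  shows "sublinear_between a b (support_fun L)"
proof -
  note upper = support_fun_upper[OF assms(1)]
  have ne: "L \<noteq> {}"
    using assms(2,4) by auto
  show ?thesis
    unfolding sublinear_between_def
  proof (intro conjI allI impI)
    fix u v :: "real ^ 'n"
    show "support_fun L (u + v) \<le> support_fun L u + support_fun L v"
      by (rule support_fun_least[OF ne]) (simp add: inner_add_right add_mono upper)
    show "support_fun L u \<le> b * norm u"
    proof (rule support_fun_least[OF ne])
      fix x assume "x \<in> L"
      have "x \<bullet> u \<le> norm x * norm u"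
        by (rule norm_cauchy_schwarz)
      also have "\<dots> \<le> b * norm u"
        using assms(3) \<open>x \<in> L\<close> by (intro mult_right_mono) auto
      finally show "x \<bullet> u \<le> b * norm u" .
    qed
    show "a * norm u \<le> support_fun L u"
    proof (cases "u = 0")
      case False
      have "(a / norm u) *\<^sub>R u \<in> L"
        using assms(2,4) False by auto
      from upper[OF this, of u] False show ?thesis
        by (simp add: dot_square_norm power2_eq_square)
    next
      case True
      have "0 \<in> L"
        using assms(2,4) by auto
      from upper[OF this, of u] True show ?thesis by simp
    qed
  next
    fix c :: real and u :: "real ^ 'n" assume "0 \<le> c"
    show "support_fun L (c *\<^sub>R u) = c * support_fun L u"
    proof (rule antisym)
      show "support_fun L (c *\<^sub>R u) \<le> c * support_fun L u"
        using \<open>0 \<le> c\<close> by (intro support_fun_least[OF ne]) (simp add: mult_left_mono upper)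
      obtain x where "x \<in> L" "support_fun L u = x \<bullet> u"
        using support_fun_attained[OF assms(1) ne] by metis
      then show "c * support_fun L u \<le> support_fun L (c *\<^sub>R u)"
        using upper[of x "c *\<^sub>R u"] by simp
    qed
  qed
qed

text \<open>The outer radius is prescribed, since a minimizing sequence needs a common one; the
  inner radius may depend on L.\<close>

lemma convex_bodies_o_support_fun_upper:
  assumes "L \<in> convex_bodies_o" "L \<subseteq> cball 0 b"
  obtains a where "0 < a" "sublinear_between a b (support_fun L)"
proof -
  have "compact L" "0 \<in> interior L"
    using assms by (auto simp: convex_bodies_o_def convex_body_def)
  then obtain a where "0 < a" "cball 0 a \<subseteq> L"
    using mem_interior_cball by blast
  then show ?thesis
    using sublinear_between_support_fun[OF \<open>compact L\<close> _ assms(2)] by (intro that[of a]) auto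
qed

lemma convex_bodies_o_support_fun:
  assumes "L \<in> convex_bodies_o"
  obtains a b where "0 < a" "sublinear_between a b (support_fun L)"
proof -
  have "bounded L"
    using assms by (simp add: convex_bodies_o_def convex_body_def compact_imp_bounded)
  then obtain b where "L \<subseteq> cball 0 b"
    by (auto simp: bounded_iff subset_iff)
  then show ?thesis
    using convex_bodies_o_support_fun_upper[OF assms] that by blast
qed

text \<open>Since the polar body is the unit sublevel set of the support function, the results on
  sublevel sets apply to the normalization; closedness of that set allows passing from
  \<open>lebesgue\<close> to \<open>lborel\<close>.\<close>

lemma volume_polar_body:
  assumes "L \<in> convex_bodies_o"
  shows "volume (polar_body L) = measure lborel {y. support_fun L y \<le> 1}"
proof -
  obtain a b where h: "0 < a" "sublinear_between a b (support_fun L)"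
    using convex_bodies_o_support_fun[OF assms] .
  have "compact L" "L \<noteq> {}"
    using assms interior_subset by (auto simp: convex_bodies_o_def convex_body_def)
  then have eq: "polar_body L = {y. support_fun L y \<le> 1}"
    using support_fun_upper[OF \<open>compact L\<close>] support_fun_least[OF \<open>L \<noteq> {}\<close>]
    unfolding polar_body_def by (auto intro: order_trans)
  have "{y. support_fun L y \<le> 1} \<in> sets lborel"
    using compact_imp_closed[OF sublevel_props(1)[OF h(2,1)]] by simp
  then show ?thesis
    by (simp add: volume_def eq)
qed

section \<open>Recovering bodies from sublinear functions\<close>

text \<open>The Wulff shape of h, an intersection of half-spaces. For positively homogeneous h with
  h 0 = 0, ranging over all u gives the same set as ranging over unit vectors.\<close>

definition wulff_body :: "('a::real_inner \<Rightarrow> real) \<Rightarrow> 'a set" where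
  "wulff_body h = {x. \<forall>u. x \<bullet> u \<le> h u}"

text \<open>A point outside L is strictly separated from L, so it violates the support inequality in
  the direction of the separating normal. Hence equal support functions force equal bodies.\<close>

lemma wulff_body_support_fun:
  assumes "L \<in> convex_bodies_o"
  shows "wulff_body (support_fun L) = L"
proof
  have L: "compact L" "convex L" "L \<noteq> {}"
    using assms interior_subset by (auto simp: convex_bodies_o_def convex_body_def)
  show "L \<subseteq> wulff_body (support_fun L)"
    using support_fun_upper[OF L(1)] by (auto simp: wulff_body_def)
  show "wulff_body (support_fun L) \<subseteq> L"
  proof (rule ccontr)
    assume "\<not> wulff_body (support_fun L) \<subseteq> L"
    then obtain z where z: "z \<notin> L" "\<And>u. z \<bullet> u \<le> support_fun L u"
      by (auto simp: wulff_body_def)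
    obtain v c where v: "v \<bullet> z < c" "\<forall>x\<in>L. c < v \<bullet> x"
      using separating_hyperplane_closed_point[OF L(2) compact_imp_closed[OF L(1)] z(1)] by blast
    have "support_fun L (- v) \<le> - c"
      using v(2) by (intro support_fun_least[OF L(3)]) (auto simp: inner_commute intro: less_imp_le)
    with z(2)[of "- v"] v(1) show False
      by (simp add: inner_commute)
  qed
qed

lemma wulff_body_convex_bodies_o:
  fixes h :: "real ^ 'n \<Rightarrow> real"
  assumes h: "sublinear_between a b h" "0 < a"
  shows "wulff_body h \<in> convex_bodies_o"
proof -
  have "cball 0 a \<subseteq> wulff_body h"
  proof (clarsimp simp: wulff_body_def)
    fix x u :: "real ^ 'n" assume "norm x \<le> a"
    have "x \<bullet> u \<le> norm x * norm u"
      by (rule norm_cauchy_schwarz)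
    also have "\<dots> \<le> a * norm u"
      using \<open>norm x \<le> a\<close> by (intro mult_right_mono) auto
    also have "\<dots> \<le> h u"
      by (rule sublinear_betweenD(3)[OF h(1)])
    finally show "x \<bullet> u \<le> h u" .
  qed
  then have int: "0 \<in> interior (wulff_body h)"
    using h(2) mem_interior_cball by blast
  have eq: "wulff_body h = (\<Inter>u. {x. u \<bullet> x \<le> h u})"
    by (auto simp: wulff_body_def inner_commute)
  have "closed (wulff_body h)" "convex (wulff_body h)"
    unfolding eq by (auto intro!: closed_INT convex_INT simp: closed_halfspace_le convex_halfspace_le)
  moreover have "norm x \<le> b" if "x \<in> wulff_body h" for x
  proof (cases "x = 0")
    case False
    have "x \<bullet> x \<le> h x"
      using that by (simp add: wulff_body_def)
    then have "norm x * norm x \<le> b * norm x"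
      using sublinear_betweenD(4)[OF h(1), of x] by (simp add: dot_square_norm power2_eq_square)
    then show ?thesis using False by simp
  next
    case True
    \<comment> \<open>The origin needs 0 <= b, which follows from the two bounds at a unit
      vector.\<close>
    obtain v :: "real ^ 'n" where "norm v = 1"
      using vector_choose_size[of 1] by auto
    then show ?thesis
      using True sublinear_betweenD(3,4)[OF h(1), of v] h(2) by simp
  qed
  then have "bounded (wulff_body h)"
    by (auto simp: bounded_iff)
  ultimately show ?thesis
    using int by (auto simp: convex_bodies_o_def convex_body_def compact_eq_bounded_closed)
qed

text \<open>A separation argument: if the support function were below t < h y at y, then y would lie
  outside the compact convex set {h <= t}, and the separating normal, rescaled, would be a point of
  the Wulff body beyond level t in direction y.\<close>

lemma support_fun_wulff_body:
  fixes h :: "real ^ 'n \<Rightarrow> real"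
  assumes h: "sublinear_between a b h" "0 < a"
  shows "support_fun (wulff_body h) = h"
proof
  fix y
  have W: "wulff_body h \<in> convex_bodies_o"
    by (rule wulff_body_convex_bodies_o[OF h])
  then have W': "compact (wulff_body h)" "wulff_body h \<noteq> {}"
    using interior_subset by (auto simp: convex_bodies_o_def convex_body_def)
  have le: "support_fun (wulff_body h) u \<le> h u" for u
    by (rule support_fun_least[OF W'(2)]) (simp add: wulff_body_def)
  show "support_fun (wulff_body h) y = h y"
  proof (rule ccontr)
    let ?s = "support_fun (wulff_body h)"
    assume "?s y \<noteq> h y"
    then have lt: "?s y < h y"
      using le[of y] by simp
    then have "y \<noteq> 0"
      using convex_bodies_o_support_fun[OF W] sublinear_betweenD(5) h(1) by (metis less_irrefl)
    obtain t where t: "?s y < t" "t < h y"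
      using lt dense by blast
    have "0 < ?s y"
      using convex_bodies_o_support_fun[OF W] sublinear_between_pos \<open>y \<noteq> 0\<close> by metis
    then have "0 < t" using t by simp
    have "y \<notin> {x. h x \<le> t}" using t by simp
    then obtain v c where v: "v \<bullet> y < c" "\<forall>x\<in>{x. h x \<le> t}. c < v \<bullet> x"
      using separating_hyperplane_closed_point[OF sublevel_props(2)[OF h] compact_imp_closed[OF sublevel_props(1)[OF h]]]
      by blast
    \<comment> \<open>The origin lies in {h <= t}, so c < v . 0.\<close>
    have "c < 0"
      using v(2)[rule_format, of 0] \<open>0 < t\<close> by (simp add: sublinear_betweenD(5)[OF h(1)])
    \<comment> \<open>As t / c is negative, the half-space c < v . u becomes x . u < t. Scaling each
      nonzero u to the level h = t then gives x . u <= h u.\<close>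
    define x where "x = (t / c) *\<^sub>R v"
    have "x \<bullet> u \<le> h u" for u
    proof (cases "u = 0")
      case False
      then have pos: "0 < h u" by (rule sublinear_between_pos[OF h])
      then have "h ((t / h u) *\<^sub>R u) \<le> t"
        using \<open>0 < t\<close> by (simp add: sublinear_betweenD(2)[OF h(1)])
      then have "c < v \<bullet> ((t / h u) *\<^sub>R u)"
        using v(2) by blast
      then show ?thesis
        using \<open>c < 0\<close> pos by (simp add: x_def field_simps)
    qed (simp add: sublinear_betweenD(5)[OF h(1)])
    then have "x \<in> wulff_body h" by (simp add: wulff_body_def)
    then have "x \<bullet> y \<le> ?s y"
      by (rule support_fun_upper[OF W'(1)])
    moreover have "t < x \<bullet> y"
      using v(1) \<open>c < 0\<close> \<open>0 < t\<close> by (simp add: x_def field_simps)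
    ultimately show False using t by simp
  qed
qed

lemma wulff_body_normalized:
  fixes h :: "real ^ 'n \<Rightarrow> real"
  assumes h: "sublinear_between a b h" "0 < a"
    and V: "measure lborel {x. h x \<le> 1} = volume (cball (0 :: real ^ 'n) 1)"
  shows "wulff_body h \<in> normalized_bodies"
  using wulff_body_convex_bodies_o[OF h] V volume_polar_body[OF wulff_body_convex_bodies_o[OF h]]
  by (simp add: normalized_bodies_def support_fun_wulff_body[OF h])

lemma volume_unit_ball: "volume (cball (0 :: real ^ 'n) 1) = measure lborel (cball (0 :: real ^ 'n) 1)"
  "0 < volume (cball (0 :: real ^ 'n) 1)"
  by (simp_all add: volume_def content_cball)

text \<open>Makes the real-valued \<open>INF\<close> a genuine infimum. The witness is the unit
  ball, as the Wulff body of the norm.\<close>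

lemma normalized_bodies_nonempty: "normalized_bodies \<noteq> ({} :: (real ^ 'n) set set)"
proof -
  have "sublinear_between 1 1 (norm :: real ^ 'n \<Rightarrow> real)"
    by (simp add: sublinear_between_def norm_triangle_ineq)
  moreover have "{x :: real ^ 'n. norm x \<le> 1} = cball 0 1"
    by auto
  ultimately have "wulff_body norm \<in> (normalized_bodies :: (real ^ 'n) set set)"
    by (intro wulff_body_normalized) (auto simp: volume_unit_ball)
  then show ?thesis by blast
qed

lemma normalized_bodies_iff:
  fixes L :: "(real ^ 'n) set"
  shows
  "L \<in> normalized_bodies \<longleftrightarrow>
    L \<in> convex_bodies_o \<and> measure lborel {y. support_fun L y \<le> 1} = volume (cball (0 :: real ^ 'n) 1)"
  by (auto simp: normalized_bodies_def volume_polar_body)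

section \<open>The Orlicz functional\<close>

lemma orlicz_functional_wulff_body:
  assumes "sublinear_between a b h" "0 < a"
  shows "orlicz_functional \<mu> \<phi> (wulff_body h) = (\<integral>u. \<phi> (h u) \<partial>\<mu>)"
  by (simp add: orlicz_functional_def support_fun_wulff_body[OF assms])

context
  fixes \<phi> :: "real \<Rightarrow> real"
  assumes \<phi>: "\<phi> \<in> increasing_class"
begin

lemma increasing_class_pos: "0 < t \<Longrightarrow> 0 < \<phi> t"
  and increasing_class_mono: "0 < s \<Longrightarrow> s \<le> t \<Longrightarrow> \<phi> s \<le> \<phi> t"
  and increasing_class_strict_mono: "0 < s \<Longrightarrow> s < t \<Longrightarrow> \<phi> s < \<phi> t"
  using \<phi> by (auto simp: increasing_class_def strict_mono_on_def le_less)

lemma increasing_class_continuous: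
  fixes h :: "'a::real_normed_vector \<Rightarrow> real"
  assumes "sublinear_between a b h" "0 < a"
  shows "continuous_on (sphere 0 1) (\<lambda>u. \<phi> (h u))"
proof (rule continuous_on_compose2[where g = \<phi> and f = h and t = "{0<..}"])
  show "continuous_on {0<..} \<phi>"
    using \<phi> by (simp add: increasing_class_def)
  show "h ` sphere 0 1 \<subseteq> {0<..}"
    using sublinear_between_sphere(1)[OF assms(1)] assms(2) by (auto intro: less_le_trans)
qed (rule sublinear_between_continuous_on[OF assms(1)])

end

section \<open>Integration against a measure on the sphere\<close>

context
  fixes \<mu> :: "(real ^ 'n) measure"
  assumes \<mu>: "\<mu> \<in> sphere_measures"
begin

lemma sphere_measure_space: "space \<mu> = sphere 0 1"
  using sets_eq_imp_space_eq[of \<mu> "restrict_space borel (sphere 0 1)"] \<mu>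
  by (simp add: sphere_measures_def space_restrict_space)

lemma sphere_measure_finite: "finite_measure \<mu>"
  using \<mu> by (simp add: sphere_measures_def)

lemma sphere_measure_pos: "0 < measure \<mu> (space \<mu>)"
  using \<mu> finite_measure.emeasure_eq_measure[OF sphere_measure_finite]
  by (auto simp: sphere_measures_def zero_less_measure_iff)

lemma sphere_measure_measurable:
  fixes f :: "real ^ 'n \<Rightarrow> real"
  assumes "continuous_on (sphere 0 1) f"
  shows "f \<in> borel_measurable \<mu>"
proof -
  have "sets \<mu> = sets (restrict_space borel (sphere 0 1))"
    using \<mu> by (simp add: sphere_measures_def)
  then show ?thesis
    using borel_measurable_continuous_on_restrict[OF assms] measurable_cong_sets by blast
qed

lemma sphere_measure_integrable:
  fixes f :: "real ^ 'n \<Rightarrow> real"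
  assumes "continuous_on (sphere 0 1) f"
  shows "integrable \<mu> f"
proof -
  have "bounded (f ` sphere 0 1)"
    by (intro compact_imp_bounded compact_continuous_image assms compact_sphere)
  then obtain B where "\<And>u. u \<in> sphere 0 1 \<Longrightarrow> norm (f u) \<le> B"
    unfolding bounded_iff by blast
  then show ?thesis
    by (intro finite_measure.integrable_const_bound[OF sphere_measure_finite, of f B] AE_I2
        sphere_measure_measurable assms) (simp add: sphere_measure_space)
qed

lemma sphere_measure_integral_mono:
  fixes f g :: "real ^ 'n \<Rightarrow> real"
  assumes "continuous_on (sphere 0 1) f" "continuous_on (sphere 0 1) g" "\<And>u. u \<in> sphere 0 1 \<Longrightarrow> f u \<le> g u"
  shows "(\<integral>u. f u \<partial>\<mu>) \<le> (\<integral>u. g u \<partial>\<mu>)"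
  by (intro integral_mono sphere_measure_integrable assms) (use assms(3) sphere_measure_space in auto)

text \<open>Uniform form of non-concentration: the integral is continuous in v by dominated
  convergence and positive, so it has a positive minimum on the compact sphere.\<close>

lemma sphere_measure_positive_part_bound:
  obtains c where "0 < c" "\<And>v. v \<in> sphere 0 1 \<Longrightarrow> c \<le> (\<integral>u. max (u \<bullet> v) 0 \<partial>\<mu>)"
proof -
  let ?G = "\<lambda>v. \<integral>u. max (u \<bullet> v) 0 \<partial>\<mu>"
  have int: "integrable \<mu> (\<lambda>u. max (u \<bullet> v) 0)" for v
    by (intro sphere_measure_integrable continuous_intros)
  have "continuous_on (sphere 0 1) ?G"
  proof (rule continuous_on_sequentiallyI)
    fix V :: "nat \<Rightarrow> real ^ 'n" and v
    assume V: "\<forall>n. V n \<in> sphere 0 1" "V \<longlonglongrightarrow> v"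
    show "(\<lambda>n. ?G (V n)) \<longlonglongrightarrow> ?G v"
    proof (rule integral_dominated_convergence[where w = "\<lambda>_. 1"])
      show "AE u in \<mu>. (\<lambda>n. max (u \<bullet> V n) 0) \<longlonglongrightarrow> max (u \<bullet> v) 0"
        by (intro AE_I2 tendsto_intros V)
      show "AE u in \<mu>. norm (max (u \<bullet> V n) 0) \<le> 1" for n
      proof (rule AE_I2)
        fix u assume "u \<in> space \<mu>"
        then have "u \<bullet> V n \<le> 1"
          using norm_cauchy_schwarz[of u "V n"] V(1) by (simp add: sphere_measure_space)
        then show "norm (max (u \<bullet> V n) 0) \<le> 1" by simp
      qed
      show "integrable \<mu> (\<lambda>_. 1 :: real)"
        by (intro sphere_measure_integrable continuous_intros)
    qed (use int in auto)
  qed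
  moreover have "sphere (0 :: real ^ 'n) 1 \<noteq> {}"
    using vector_choose_size[of 1] by auto
  ultimately have "\<exists>v0\<in>sphere 0 1. \<forall>v\<in>sphere 0 1. ?G v0 \<le> ?G v"
    using continuous_attains_inf[OF compact_sphere] by blast
  then obtain v0 where "v0 \<in> sphere 0 1" "\<And>v. v \<in> sphere 0 1 \<Longrightarrow> ?G v0 \<le> ?G v"
    by blast
  moreover from this(1) have "0 < ?G v0"
    using \<mu> by (simp add: sphere_measures_def)
  ultimately show ?thesis using that by blast
qed

section \<open>Coercivity and continuity of the functional\<close>

context
  fixes \<phi> :: "real \<Rightarrow> real"
  assumes \<phi>: "\<phi> \<in> increasing_class"
begin

lemmas \<phi>_pos = increasing_class_pos[OF \<phi>]
  and \<phi>_mono = increasing_class_mono[OF \<phi>]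
  and \<phi>_strict_mono = increasing_class_strict_mono[OF \<phi>]
  and \<phi>_continuous = increasing_class_continuous[OF \<phi>]

lemma orlicz_functional_nonneg:
  assumes "L \<in> convex_bodies_o"
  shows "0 \<le> orlicz_functional \<mu> \<phi> L"
  unfolding orlicz_functional_def
proof (rule integral_nonneg_AE, rule AE_I2)
  fix u assume "u \<in> space \<mu>"
  obtain a b where "0 < a" "sublinear_between a b (support_fun L)"
    using convex_bodies_o_support_fun[OF assms] .
  then have "0 < support_fun L u"
    using \<open>u \<in> space \<mu>\<close> by (intro sublinear_between_pos) (auto simp: sphere_measure_space)
  then show "0 \<le> \<phi> (support_fun L u)"
    by (simp add: \<phi>_pos less_imp_le)
qed

text \<open>If L has a far point x in direction v, then h_L(u) >= norm x * (u . v) is large on the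
  cap u . v >= \<delta>. That cap has mass at least c / 2 for every v, so the functional exceeds
  C.\<close>

lemma orlicz_functional_coercive:
  obtains R where "0 < R"
    "\<And>L. L \<in> convex_bodies_o \<Longrightarrow> orlicz_functional \<mu> \<phi> L \<le> C \<Longrightarrow> L \<subseteq> cball 0 R"
proof -
  obtain c where c: "0 < c" "\<And>v. v \<in> sphere 0 1 \<Longrightarrow> c \<le> (\<integral>u. max (u \<bullet> v) 0 \<partial>\<mu>)"
    using sphere_measure_positive_part_bound by blast
  define m where "m = measure \<mu> (space \<mu>)"
  have "0 < m" unfolding m_def by (rule sphere_measure_pos)
  \<comment> \<open>Chosen so that \<delta> * m = c / 2: directions outside the cap account for at
    most half of c.\<close>
  define \<delta> where "\<delta> = c / (2 * m)"
  have "0 < \<delta>" using \<open>0 < c\<close> \<open>0 < m\<close> by (simp add: \<delta>_def)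
  \<comment> \<open>Chosen so that K times the mass c / 2 exceeds C; the summand 1 makes this strict
    and K positive.\<close>
  define K where "K = 2 * \<bar>C\<bar> / c + 1"
  have "K * (c / 2) = \<bar>C\<bar> + c / 2"
    using \<open>0 < c\<close> by (simp add: K_def field_simps)
  then have "0 < K" "C < K * (c / 2)"
    using \<open>0 < c\<close> by (auto simp: K_def intro: add_nonneg_pos)
  have "filterlim \<phi> at_top at_top"
    using \<phi> by (simp add: increasing_class_def)
  then have "\<forall>\<^sub>F t in at_top. K \<le> \<phi> t"
    by (simp add: filterlim_at_top)
  then obtain T0 where T0: "\<And>t. T0 \<le> t \<Longrightarrow> K \<le> \<phi> t"
    by (auto simp: eventually_at_top_linorder)
  define T where "T = max T0 1"
  have T: "0 < T" "\<And>t. T \<le> t \<Longrightarrow> K \<le> \<phi> t"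
    using T0 by (auto simp: T_def)
  show ?thesis
  proof (rule that)
    show "0 < T / \<delta>" using T(1) \<open>0 < \<delta>\<close> by simp
    fix L :: "(real ^ 'n) set"
    assume L: "L \<in> convex_bodies_o" and FC: "orlicz_functional \<mu> \<phi> L \<le> C"
    show "L \<subseteq> cball 0 (T / \<delta>)"
    proof (rule ccontr)
      assume "\<not> L \<subseteq> cball 0 (T / \<delta>)"
      then obtain x where "x \<in> L" and x: "T / \<delta> < norm x"
        by (meson mem_cball_0 not_le subsetI)
      moreover have "0 < T / \<delta>"
        using T(1) \<open>0 < \<delta>\<close> by simp
      ultimately have "0 < norm x"
        by linarith
      then have "x \<noteq> 0" by auto
      define v where "v = sgn x"
      have v: "norm v = 1" "x = norm x *\<^sub>R v"
        using \<open>x \<noteq> 0\<close> by (auto simp: v_def norm_sgn sgn_div_norm)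
      define A where "A = {u \<in> space \<mu>. \<delta> \<le> u \<bullet> v}"
      have A: "A \<in> sets \<mu>"
      proof -
        have [measurable]: "(\<lambda>u. u \<bullet> v) \<in> borel_measurable \<mu>"
          by (intro sphere_measure_measurable continuous_intros)
        show ?thesis unfolding A_def by measurable
      qed
      have intA: "integrable \<mu> (indicat_real A)"
        using A finite_measure.emeasure_finite[OF sphere_measure_finite, of A]
        by (intro integrable_real_indicator) (auto simp: top.not_eq_extremum)
      have "c \<le> (\<integral>u. max (u \<bullet> v) 0 \<partial>\<mu>)"
        using c(2) v(1) by simp
      \<comment> \<open>The positive part is below \<delta> off the cap and at most 1 on it.\<close>
      also have "\<dots> \<le> (\<integral>u. \<delta> + indicat_real A u \<partial>\<mu>)"
      proof (rule integral_mono)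
        fix u assume u: "u \<in> space \<mu>"
        then have "u \<bullet> v \<le> 1"
          using norm_cauchy_schwarz[of u v] v(1) by (simp add: sphere_measure_space)
        then show "max (u \<bullet> v) 0 \<le> \<delta> + indicat_real A u"
          using u \<open>0 < \<delta>\<close> by (auto simp: A_def indicator_def)
      next
        show "integrable \<mu> (\<lambda>u. \<delta> + indicat_real A u)"
          by (intro Bochner_Integration.integrable_add intA finite_measure.integrable_const sphere_measure_finite)
        show "integrable \<mu> (\<lambda>u. max (u \<bullet> v) 0)"
          by (intro sphere_measure_integrable continuous_intros)
      qed
      also have "\<dots> = \<delta> * m + measure \<mu> A"
        using A intA finite_measure.integrable_const[OF sphere_measure_finite, of \<delta>]
        by (simp add: m_def)
      finally have "c / 2 \<le> measure \<mu> A"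
        using \<open>0 < m\<close> by (simp add: \<delta>_def)
      obtain a b where h: "0 < a" "sublinear_between a b (support_fun L)"
        using convex_bodies_o_support_fun[OF L] .
      have "C < K * (c / 2)" by fact
      also have "\<dots> \<le> K * measure \<mu> A"
        using \<open>c / 2 \<le> measure \<mu> A\<close> \<open>0 < K\<close> by simp
      also have "\<dots> = (\<integral>u. K * indicat_real A u \<partial>\<mu>)"
        using A by simp
      also have "\<dots> \<le> (\<integral>u. \<phi> (support_fun L u) \<partial>\<mu>)"
      proof (rule integral_mono)
        show "integrable \<mu> (\<lambda>u. K * indicat_real A u)"
          by (intro integrable_mult_right intA)
        show "integrable \<mu> (\<lambda>u. \<phi> (support_fun L u))"
          by (intro sphere_measure_integrable \<phi>_continuous[OF h(2,1)])
        fix u assume u: "u \<in> space \<mu>"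
        show "K * indicat_real A u \<le> \<phi> (support_fun L u)"
        proof (cases "u \<in> A")
          case True
          have "T \<le> norm x * \<delta>"
            using x \<open>0 < \<delta>\<close> by (simp add: field_simps)
          also have "\<dots> \<le> norm x * (u \<bullet> v)"
            using True by (intro mult_left_mono) (auto simp: A_def)
          also have "\<dots> = x \<bullet> u"
            by (subst (2) v(2)) (simp add: inner_commute)
          also have "\<dots> \<le> support_fun L u"
            using L \<open>x \<in> L\<close> by (intro support_fun_upper) (auto simp: convex_bodies_o_def convex_body_def)
          finally show ?thesis using T(2) True by simp
        next
          case False
          have "0 < support_fun L u"
            using u by (intro sublinear_between_pos[OF h(2,1)]) (auto simp: sphere_measure_space)
          then show ?thesis
            using False \<phi>_pos by (simp add: less_imp_le)
        qed
      qed
      also have "\<dots> = orlicz_functional \<mu> \<phi> L"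
        by (simp add: orlicz_functional_def)
      finally show False using FC by simp
    qed
  qed
qed

text \<open>On the sphere all values lie in [a, b] with a > 0, so \<phi> is continuous at the limits
  and the constant \<open>\<phi> b\<close> dominates.\<close>

lemma integral_sublinear_tendsto:
  assumes h: "\<And>n. sublinear_between a b (h n)" and "0 < a"
    and lim: "\<And>x. (\<lambda>n. h n x) \<longlonglongrightarrow> k x"
  shows "(\<lambda>n. \<integral>u. \<phi> (h n u) \<partial>\<mu>) \<longlonglongrightarrow> (\<integral>u. \<phi> (k u) \<partial>\<mu>)"
proof (rule integral_dominated_convergence[where w = "\<lambda>_. \<phi> b"])
  have k: "sublinear_between a b k"
    by (rule sublinear_between_tendsto[OF h lim])
  show "(\<lambda>u. \<phi> (k u)) \<in> borel_measurable \<mu>" "(\<lambda>u. \<phi> (h n u)) \<in> borel_measurable \<mu>" for n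
    by (intro sphere_measure_measurable \<phi>_continuous[OF k] \<phi>_continuous[OF h] \<open>0 < a\<close>)+
  show "integrable \<mu> (\<lambda>_. \<phi> b)"
    by (intro sphere_measure_integrable continuous_intros)
  show "AE u in \<mu>. (\<lambda>n. \<phi> (h n u)) \<longlonglongrightarrow> \<phi> (k u)"
  proof (rule AE_I2)
    fix u assume "u \<in> space \<mu>"
    then have "0 < k u"
      by (intro sublinear_between_pos[OF k \<open>0 < a\<close>]) (auto simp: sphere_measure_space)
    then have "isCont \<phi> (k u)"
      using \<phi> by (auto simp: increasing_class_def continuous_on_eq_continuous_at)
    then show "(\<lambda>n. \<phi> (h n u)) \<longlonglongrightarrow> \<phi> (k u)"
      using lim by (rule isCont_tendsto_compose)
  qed
  show "AE u in \<mu>. norm (\<phi> (h n u)) \<le> \<phi> b" for n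
  proof (rule AE_I2)
    fix u assume "u \<in> space \<mu>"
    then have "a \<le> h n u" "h n u \<le> b"
      using sublinear_between_sphere[OF h] by (auto simp: sphere_measure_space)
    then show "norm (\<phi> (h n u)) \<le> \<phi> b"
      using \<open>0 < a\<close> \<phi>_pos[of "h n u"] \<phi>_mono[of "h n u" b] by simp
  qed
qed

lemma INF_orlicz_functional_le:
  assumes "L \<in> normalized_bodies"
  shows "(INF L\<in>normalized_bodies. orlicz_functional \<mu> \<phi> L) \<le> orlicz_functional \<mu> \<phi> L"
proof (rule cINF_lower[OF _ assms])
  show "bdd_below (orlicz_functional \<mu> \<phi> ` normalized_bodies)"
    using orlicz_functional_nonneg by (intro bdd_belowI2[of _ 0]) (auto simp: normalized_bodies_def)
qed

section \<open>Existence of a minimizer\<close>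

lemma orlicz_minimizer_exists:
  obtains M where "M \<in> normalized_bodies"
    "orlicz_functional \<mu> \<phi> M = (INF L\<in>normalized_bodies. orlicz_functional \<mu> \<phi> L)"
proof -
  define I where "I = (INF L\<in>normalized_bodies. orlicz_functional \<mu> \<phi> L)"
  let ?\<omega> = "volume (cball (0 :: real ^ 'n) 1)"
  have "\<exists>L\<in>normalized_bodies. orlicz_functional \<mu> \<phi> L < I + 1 / real (Suc n)" for n
    using cInf_lessD[of "orlicz_functional \<mu> \<phi> ` normalized_bodies" "I + 1 / real (Suc n)"] normalized_bodies_nonempty
    by (auto simp: I_def)
  then obtain L where L: "\<And>n. L n \<in> normalized_bodies"
    and FL: "\<And>n. orlicz_functional \<mu> \<phi> (L n) < I + 1 / real (Suc n)"
    by metis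
  have Lo: "L n \<in> convex_bodies_o" for n
    using L by (simp add: normalized_bodies_def)
  obtain R where "0 < R"
    and R: "\<And>L. L \<in> convex_bodies_o \<Longrightarrow> orlicz_functional \<mu> \<phi> L \<le> I + 1 \<Longrightarrow> L \<subseteq> cball 0 R"
    using orlicz_functional_coercive[of "I + 1"] by blast
  have LR: "L n \<subseteq> cball 0 R" for n
  proof (rule R[OF Lo])
    have "1 / real (Suc n) \<le> 1" by simp
    with FL[of n] show "orlicz_functional \<mu> \<phi> (L n) \<le> I + 1" by linarith
  qed
  \<comment> \<open>Gives equality in the volume hypothesis of
    \<open>sublinear_between_of_measure\<close> with b = R, so all the bodies share the inner radius
    1 / D.\<close>
  define D where "D = 2 * ?\<omega> / (R * measure lborel (ball (0 :: real ^ 'n) (1 / (2 * R))))"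
  have D: "0 < D" "D * (R * measure lborel (ball (0 :: real ^ 'n) (1 / (2 * R)))) = 2 * ?\<omega>"
    using \<open>0 < R\<close> volume_unit_ball(2)[where 'n = 'n] by (auto simp: D_def content_ball unit_ball_vol_pos[THEN less_imp_neq, symmetric])
  have h: "sublinear_between (1 / D) R (support_fun (L n))" for n
  proof -
    obtain a where "0 < a" "sublinear_between a R (support_fun (L n))"
      using convex_bodies_o_support_fun_upper[OF Lo LR] .
    then show ?thesis
      using \<open>0 < R\<close> D L[of n] by (intro sublinear_between_of_measure) (auto simp: normalized_bodies_iff)
  qed
  obtain k r where "strict_mono (r :: nat \<Rightarrow> nat)"
    and k: "\<And>x. (\<lambda>n. support_fun (L (r n)) x) \<longlonglongrightarrow> k x"
    using sublinear_between_convergent_subseq[where h = "\<lambda>n. support_fun (L n)", OF h] by blast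
  have "0 < 1 / D" using D(1) by simp
  note lim = sublevel_measure_tendsto[where h = "\<lambda>n. support_fun (L (r n))", OF h \<open>0 < 1 / D\<close> k]
    integral_sublinear_tendsto[where h = "\<lambda>n. support_fun (L (r n))", OF h \<open>0 < 1 / D\<close> k]
  have sk: "sublinear_between (1 / D) R k"
    by (rule sublinear_between_tendsto[OF h k])
  \<comment> \<open>The volumes along the subsequence are constant, so the limit is normalized as
    well.\<close>
  have "measure lborel {x. k x \<le> 1} = ?\<omega>"
    using lim(1) L by (simp add: normalized_bodies_iff LIMSEQ_const_iff)
  then have M: "wulff_body k \<in> normalized_bodies"
    by (rule wulff_body_normalized[OF sk \<open>0 < 1 / D\<close>])
  have "(\<integral>u. \<phi> (k u) \<partial>\<mu>) \<le> I + 0"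
  proof (rule LIMSEQ_le[OF lim(2)])
    show "(\<lambda>n. I + 1 / real (Suc (r n))) \<longlonglongrightarrow> I + 0"
      using LIMSEQ_subseq_LIMSEQ[OF LIMSEQ_Suc[OF lim_1_over_n] \<open>strict_mono r\<close>]
      by (intro tendsto_add[OF tendsto_const]) (simp add: o_def)
    show "\<exists>N. \<forall>n\<ge>N. (\<integral>u. \<phi> (support_fun (L (r n)) u) \<partial>\<mu>) \<le> I + 1 / real (Suc (r n))"
      using FL by (auto simp: orlicz_functional_def less_imp_le)
  qed
  then have "orlicz_functional \<mu> \<phi> (wulff_body k) = I"
    using INF_orlicz_functional_le[OF M]
    by (simp add: I_def orlicz_functional_wulff_body[OF sk \<open>0 < 1 / D\<close>])
  with M that show ?thesis by (simp add: I_def)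
qed

section \<open>Strict decrease under shrinking, and uniqueness\<close>

lemma orlicz_functional_scale_less:
  assumes h: "sublinear_between a b h" "0 < a" and c: "0 < c" "c < 1"
  shows "(\<integral>u. \<phi> (c * h u) \<partial>\<mu>) < (\<integral>u. \<phi> (h u) \<partial>\<mu>)"
proof (rule finite_measure.integral_less_AE_space[OF sphere_measure_finite])
  show "integrable \<mu> (\<lambda>u. \<phi> (c * h u))"
    by (intro sphere_measure_integrable \<phi>_continuous[OF sublinear_between_scale[OF h(1)]])
      (use c h(2) in auto)
  show "integrable \<mu> (\<lambda>u. \<phi> (h u))"
    by (intro sphere_measure_integrable \<phi>_continuous[OF h])
  show "AE u in \<mu>. \<phi> (c * h u) < \<phi> (h u)"
  proof (rule AE_I2)
    fix u assume "u \<in> space \<mu>"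
    then have "0 < h u"
      by (intro sublinear_between_pos[OF h]) (auto simp: sphere_measure_space)
    then show "\<phi> (c * h u) < \<phi> (h u)"
      using c by (intro \<phi>_strict_mono) auto
  qed
  show "emeasure \<mu> (space \<mu>) \<noteq> 0"
    using \<mu> by (simp add: sphere_measures_def)
qed

text \<open>A body whose polar is too small can be shrunk until it is normalized, which strictly
  lowers the functional. So its own value lies strictly above the infimum.\<close>

lemma INF_orlicz_functional_less:
  fixes h :: "real ^ 'n \<Rightarrow> real"
  assumes h: "sublinear_between a b h" "0 < a" "0 < b"
    and V: "measure lborel {x. h x \<le> 1} < volume (cball (0 :: real ^ 'n) 1)"
  shows "(INF L\<in>normalized_bodies. orlicz_functional \<mu> \<phi> L) < (\<integral>u. \<phi> (h u) \<partial>\<mu>)"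
proof -
  let ?V = "measure lborel {x. h x \<le> 1}" and ?\<omega> = "volume (cball (0 :: real ^ 'n) 1)"
  \<comment> \<open>Scaling h by c multiplies the sublevel volume by c^(-n), so the target volume
    forces c^n to be the ratio of the two volumes, here less than 1.\<close>
  define c where "c = root DIM(real ^ 'n) (?V / ?\<omega>)"
  have pos: "0 < ?V / ?\<omega>" "?V / ?\<omega> < 1"
    using V volume_unit_ball(2)[where 'n = 'n] sublevel_measure_pos[OF h] by auto
  then have c: "0 < c" "c < 1" "c ^ DIM(real ^ 'n) = ?V / ?\<omega>"
    unfolding c_def by (auto simp: real_root_pow_pos2)
  have ch: "sublinear_between (c * a) (c * b) (\<lambda>x. c * h x)" "0 < c * a"
    using sublinear_between_scale[OF h(1), of c] c h(2) by auto
  have "{x. c * h x \<le> 1} = {x. h x \<le> 1 / c}"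
    using c(1) by (auto simp: field_simps)
  then have "measure lborel {x. c * h x \<le> 1} = (1 / c) ^ DIM(real ^ 'n) * ?V"
    using sublevel_measure_scale[OF h(1), of "1 / c"] c(1) by (simp add: measure_def enn2real_mult)
  also have "\<dots> = ?\<omega>"
    unfolding power_divide c(3) using pos by auto
  finally have M: "wulff_body (\<lambda>x. c * h x) \<in> normalized_bodies"
    by (rule wulff_body_normalized[OF ch])
  have "(INF L\<in>normalized_bodies. orlicz_functional \<mu> \<phi> L) \<le> (\<integral>u. \<phi> (c * h u) \<partial>\<mu>)"
    using INF_orlicz_functional_le[OF M] by (simp add: orlicz_functional_wulff_body[OF ch])
  also have "\<dots> < (\<integral>u. \<phi> (h u) \<partial>\<mu>)"
    by (rule orlicz_functional_scale_less[OF h(1,2) c(1,2)])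
  finally show ?thesis .
qed

lemma orlicz_minimizer_unique:
  assumes "convex_on {0<..} \<phi>"
    and M: "M \<in> normalized_bodies"
      "orlicz_functional \<mu> \<phi> M = (INF L\<in>normalized_bodies. orlicz_functional \<mu> \<phi> L)"
    and N: "N \<in> normalized_bodies"
      "orlicz_functional \<mu> \<phi> N = (INF L\<in>normalized_bodies. orlicz_functional \<mu> \<phi> L)"
  shows "N = M"
proof -
  let ?I = "INF L\<in>normalized_bodies. orlicz_functional \<mu> \<phi> L"
  let ?h = "support_fun M" and ?k = "support_fun N"
  have MN: "M \<in> convex_bodies_o" "N \<in> convex_bodies_o"
    using M N by (auto simp: normalized_bodies_def)
  obtain a1 b1 where 1: "0 < a1" "sublinear_between a1 b1 ?h"
    using convex_bodies_o_support_fun[OF MN(1)] .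
  obtain a2 b2 where 2: "0 < a2" "sublinear_between a2 b2 ?k"
    using convex_bodies_o_support_fun[OF MN(2)] .
  \<comment> \<open>Common bounds for both support functions; the 1 in the maximum makes b
    positive.\<close>
  define a b where "a = min a1 a2" and "b = max 1 (max b1 b2)"
  have "0 < a" "0 < b"
    using 1(1) 2(1) by (auto simp: a_def b_def)
  have h: "sublinear_between a b ?h" and k: "sublinear_between a b ?k"
    using 1(2) 2(2) by (auto simp: a_def b_def elim: sublinear_between_mono)
  let ?q = "\<lambda>x. (?h x + ?k x) / 2"
  have q: "sublinear_between a b ?q"
    using sublinear_between_scale[OF sublinear_between_add[OF h k], of "1 / 2"] by simp
  note cont = \<phi>_continuous[OF h \<open>0 < a\<close>] \<phi>_continuous[OF k \<open>0 < a\<close>]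
    \<phi>_continuous[OF q \<open>0 < a\<close>]
  have "(\<integral>u. \<phi> (?q u) \<partial>\<mu>) \<le> (\<integral>u. (\<phi> (?h u) + \<phi> (?k u)) / 2 \<partial>\<mu>)"
  proof (rule sphere_measure_integral_mono)
    fix u :: "real ^ 'n" assume "u \<in> sphere 0 1"
    then have "0 < ?h u" "0 < ?k u"
      by (auto intro!: sublinear_between_pos[OF h \<open>0 < a\<close>] sublinear_between_pos[OF k \<open>0 < a\<close>])
    then show "\<phi> (?q u) \<le> (\<phi> (?h u) + \<phi> (?k u)) / 2"
      using convex_onD[OF assms(1), of "1 / 2" "?h u" "?k u"] by (simp add: field_simps)
  qed (intro continuous_intros cont; simp)+
  also have "\<dots> = (orlicz_functional \<mu> \<phi> M + orlicz_functional \<mu> \<phi> N) / 2"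
    using cont by (simp add: orlicz_functional_def sphere_measure_integrable)
  also have "\<dots> = ?I"
    by (simp add: M N)
  \<comment> \<open>The midpoint has value at most the infimum, so its polar volume cannot fall
    below the prescribed one; \<open>sublevel_measure_midpoint\<close> then puts it in the equality
    case.\<close>
  finally have "\<not> measure lborel {x. ?q x \<le> 1} < volume (cball (0 :: real ^ 'n) 1)"
    using INF_orlicz_functional_less[OF q \<open>0 < a\<close> \<open>0 < b\<close>] by auto
  moreover have hV: "measure lborel {x. ?h x \<le> 1} = volume (cball (0 :: real ^ 'n) 1)"
    and kV: "measure lborel {x. ?k x \<le> 1} = volume (cball (0 :: real ^ 'n) 1)"
    using M(1) N(1) by (simp_all add: normalized_bodies_iff)
  moreover have "measure lborel {x. ?q x \<le> 1} \<le> volume (cball (0 :: real ^ 'n) 1)"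
    by (rule sublevel_measure_midpoint(1)[OF h k \<open>0 < a\<close> hV kV])
  ultimately have "measure lborel {x. ?q x \<le> 1} = volume (cball (0 :: real ^ 'n) 1)"
    by linarith
  then have "?h = ?k"
    by (rule sublevel_measure_midpoint(2)[OF h k \<open>0 < a\<close> hV kV])
  then show "N = M"
    using wulff_body_support_fun MN by metis
qed

end

end

theorem theorem1p1:
  fixes \<mu> :: "(real ^ 'n) measure" and \<phi> :: "real \<Rightarrow> real"
  assumes "\<mu> \<in> sphere_measures" and "\<phi> \<in> increasing_class"
  shows "\<exists>M. M \<in> convex_bodies_o \<and>
           volume (polar_body M) = volume (cball (0 :: real ^ 'n) 1) \<and>
           orlicz_functional \<mu> \<phi> M = (INF L\<in>normalized_bodies. orlicz_functional \<mu> \<phi> L) \<and>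
           (convex_on {0<..} \<phi> \<longrightarrow>
             (\<forall>N. N \<in> convex_bodies_o \<and>
                  volume (polar_body N) = volume (cball (0 :: real ^ 'n) 1) \<and>
                  orlicz_functional \<mu> \<phi> N = (INF L\<in>normalized_bodies. orlicz_functional \<mu> \<phi> L)
                  \<longrightarrow> N = M))"
proof -
  obtain M where M: "M \<in> normalized_bodies"
    "orlicz_functional \<mu> \<phi> M = (INF L\<in>normalized_bodies. orlicz_functional \<mu> \<phi> L)"
    using orlicz_minimizer_exists[OF assms] .
  show ?thesis
  proof (intro exI conjI impI allI)
    show "M \<in> convex_bodies_o" "volume (polar_body M) = volume (cball (0 :: real ^ 'n) 1)"
      using M(1) by (auto simp: normalized_bodies_def)
    show "orlicz_functional \<mu> \<phi> M = (INF L\<in>normalized_bodies. orlicz_functional \<mu> \<phi> L)"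
      by (rule M(2))
    fix N assume "convex_on {0<..} \<phi>"
      and N: "N \<in> convex_bodies_o \<and> volume (polar_body N) = volume (cball (0 :: real ^ 'n) 1) \<and>
        orlicz_functional \<mu> \<phi> N = (INF L\<in>normalized_bodies. orlicz_functional \<mu> \<phi> L)"
    then have "N \<in> normalized_bodies"
      unfolding normalized_bodies_def by blast
    with N \<open>convex_on {0<..} \<phi>\<close> show "N = M"
      using orlicz_minimizer_unique[OF assms _ M] by blast
  qed
qed

end
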